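(* Let $a>0$ and $U_0\in F^2_{a/2}$. The solution of the heat Cauchy problem associated to the complex Dirac operator $D^a_z=\frac1a\frac{\partial}{\partial z}+\frac z2$, $$\begin{cases} D^a_z U(t,z)=\frac{\partial}{\partial t}U(t,z), & (t,z)\in(0,\infty)\times\mathbb{C},\\ U(0,z)=U_0(z), & z\in\mathbb{C},\end{cases}$$ is given by the formula $$U(t,z)=e^{\frac{zt}{2}}\,e^{\frac{t^2}{4a}}\,U_0\!\left(z+\frac ta\right).$$
   Context: For $\alpha>0$, $d\lambda_\alpha(z)=\frac{\alpha}{\pi}e^{-\alpha|z|^2}dz$ denotes the Gaussian measure on $\mathbb{C}$ ($dz$ being Lebesgue area measure), and the Fock space $F^2_\alpha$ is the space of all entire functions belonging to $L^2(\mathbb{C},d\lambda_\alpha)$. Thus $F^2_{a/2}$ is the Fock space with parameter $\alpha=a/2$. Here $\frac{\partial}{\partial z}$ is the complex derivative in $z$. *)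

theory Defs
  imports "HOL-Complex_Analysis.Complex_Analysis"
begin

definition gaussian_measure :: "real \<Rightarrow> complex measure" where
  "gaussian_measure \<alpha> =
     density lborel (\<lambda>z. ennreal (\<alpha> / pi * exp (- \<alpha> * (cmod z)\<^sup>2)))"

(* Entire functions are Borel measurable, so membership in L^2 amounts to
   integrability of the square of the modulus. *)
definition fock_space :: "real \<Rightarrow> (complex \<Rightarrow> complex) set" where
  "fock_space \<alpha> =
     {f. f holomorphic_on UNIV \<and>
         integrable (gaussian_measure \<alpha>) (\<lambda>z. (cmod (f z))\<^sup>2)}"

definition dirac :: "real \<Rightarrow> (complex \<Rightarrow> complex) \<Rightarrow> complex \<Rightarrow> complex" where
  "dirac a f z = 1 / of_real a * deriv f z + z / 2 * f z"

(* Classical solutions: the equation holds pointwise for t > 0, the time derivative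
   being the real one and the space derivative the complex one, and the initial
   value is attained continuously. Without continuity up to t = 0 the initial
   condition would not constrain U on t > 0. Membership of U t in a Fock space is
   not required for t > 0: the flow does not preserve the space of initial data.
   Values of U at t < 0 are irrelevant. *)
definition dirac_heat_solution ::
  "real \<Rightarrow> (complex \<Rightarrow> complex) \<Rightarrow> (real \<Rightarrow> complex \<Rightarrow> complex) \<Rightarrow> bool" where
  "dirac_heat_solution a U0 U \<longleftrightarrow>
     continuous_on ({0..} \<times> UNIV) (\<lambda>(t, z). U t z) \<and>
     (\<forall>t>0. U t holomorphic_on UNIV) \<and>
     (\<forall>t>0. \<forall>z. ((\<lambda>s. U s z) has_vector_derivative dirac a (U t) z) (at t)) \<and>
     (\<forall>z. U 0 z = U0 z)"

end

theory Submission
  imports Defs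
begin

text \<open>
  That the formula solves the equation is a direct computation. It is the only solution by
  the method of characteristics. Along the line \<open>s \<mapsto> (s, w - s / a)\<close> the
  transport part \<open>\<partial>\<^sub>t - (1/a) \<partial>\<^sub>z\<close> of the equation becomes \<open>d/ds\<close>, and the equation becomes
  the linear ODE \<open>y' = (w - s / a) / 2 * y\<close>. Multiplying by the integrating factor
  \<open>exp (s\<^sup>2 / (4 * a) - w * s / 2)\<close> gives a function with zero derivative on \<open>s > 0\<close> that is
  continuous on \<open>s \<ge> 0\<close>; it therefore keeps its initial value \<open>U0 w\<close>, and at \<open>s = t\<close>,
  \<open>w = z + t / a\<close> this is the formula.

  The chain rule along the characteristic needs joint differentiability of a solution, whereas
  only the two partial derivatives are given. It suffices that one of them is jointly
  continuous (\<open>has_derivative_partialsI\<close>). This holds for the complex derivative in \<open>z\<close>,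
  because Cauchy's estimate turns the joint continuity of \<open>U\<close> into that of the derivative
  (\<open>continuous_on_deriv_parametric\<close>).
\<close>

text \<open>
  Cauchy's estimate on discs of radius \<open>1\<close> bounds \<open>deriv (U t) - deriv (U t0)\<close> near \<open>z0\<close> by
  \<open>U t - U t0\<close> on the closed disc of radius \<open>2\<close> about \<open>z0\<close>, which is uniformly small for \<open>t\<close>
  near \<open>t0\<close> by compactness.
\<close>

lemma continuous_on_deriv_parametric:
  fixes U :: "'a::topological_space \<Rightarrow> complex \<Rightarrow> complex"
  assumes cont: "continuous_on (S \<times> UNIV) (\<lambda>(t, z). U t z)"
    and hol: "\<And>t. t \<in> S \<Longrightarrow> U t holomorphic_on UNIV"
  shows "continuous_on (S \<times> UNIV) (\<lambda>(t, z). deriv (U t) z)"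
proof -
  have "((\<lambda>(t, z). deriv (U t) z) \<longlongrightarrow> deriv (U t0) z0) (at (t0, z0) within S \<times> UNIV)"
    if t0: "t0 \<in> S" for t0 z0
  proof (rule tendstoI)
    fix e :: real assume "e > 0"
    have "continuous_on (S \<times> cball z0 2) (\<lambda>(t, z). U t z)"
      by (rule continuous_on_subset[OF cont]) auto
    then obtain X where X: "t0 \<in> X" "open X"
      and close: "\<forall>t\<in>X \<inter> S. \<forall>z\<in>cball z0 2.
        dist ((\<lambda>(t, z). U t z) (t, z)) ((\<lambda>(t, z). U t z) (t0, z)) \<le> e / 4"
      using t0 \<open>e > 0\<close> by (rule_tac continuous_on_prod_compactE[of S "cball z0 2" _ t0 "e / 4"]) auto
    have "deriv (U t0) holomorphic_on UNIV"
      using hol[OF t0] by (rule holomorphic_deriv) auto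
    then have "isCont (deriv (U t0)) z0"
      using holomorphic_on_imp_continuous_on continuous_on_eq_continuous_at[OF open_UNIV] by blast
    then obtain d where "d > 0"
      and d: "\<And>z. dist z z0 < d \<Longrightarrow> dist (deriv (U t0) z) (deriv (U t0) z0) < e / 2"
      unfolding continuous_at_eps_delta using \<open>e > 0\<close> by (metis half_gt_zero)
    have main: "dist (deriv (U t) z) (deriv (U t0) z0) < e"
      if t: "t \<in> X" "t \<in> S" and z: "z \<in> ball z0 (min 1 d)" for t z
    proof -
      have diff: "(\<lambda>x. U t x - U t0 x) holomorphic_on UNIV"
        by (intro holomorphic_intros hol t t0)
      have "norm ((deriv ^^ 1) (\<lambda>x. U t x - U t0 x) z) \<le> fact 1 * (e / 4) / 1 ^ 1"
      proof (rule Cauchy_inequality)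
        show "(\<lambda>x. U t x - U t0 x) holomorphic_on ball z 1"
          by (rule holomorphic_on_subset[OF diff]) auto
        show "continuous_on (cball z 1) (\<lambda>x. U t x - U t0 x)"
          by (rule continuous_on_subset[OF holomorphic_on_imp_continuous_on[OF diff]]) auto
        fix x assume "norm (z - x) = 1"
        then have "dist z0 x \<le> 2"
          using z dist_triangle[of z0 x z] by (auto simp: dist_norm)
        then show "norm (U t x - U t0 x) \<le> e / 4"
          using close t by (auto simp: dist_norm)
      qed auto
      moreover have "deriv (\<lambda>x. U t x - U t0 x) z = deriv (U t) z - deriv (U t0) z"
        using hol t t0 by (intro deriv_diff) (auto intro: holomorphic_on_imp_differentiable_at)
      ultimately have "dist (deriv (U t) z) (deriv (U t0) z) \<le> e / 4"
        by (simp add: dist_norm)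
      moreover have "dist (deriv (U t0) z) (deriv (U t0) z0) < e / 2"
        using z by (intro d) (auto simp: dist_commute)
      ultimately show ?thesis
        using dist_triangle[of "deriv (U t) z" "deriv (U t0) z0" "deriv (U t0) z"] \<open>e > 0\<close>
        by linarith
    qed
    show "\<forall>\<^sub>F x in at (t0, z0) within S \<times> UNIV.
        dist (case x of (t, z) \<Rightarrow> deriv (U t) z) (deriv (U t0) z0) < e"
      unfolding eventually_at_topological
      using X \<open>d > 0\<close> main by (intro exI[of _ "X \<times> ball z0 (min 1 d)"]) (auto intro: open_Times)
  qed
  then show ?thesis
    by (auto simp: continuous_on_def)
qed

lemma has_derivative_joint:
  fixes U :: "real \<Rightarrow> complex \<Rightarrow> complex"
  assumes cont: "continuous_on (S \<times> UNIV) (\<lambda>(t, z). U t z)" and "open S" and "t \<in> S"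
    and hol: "\<And>t. t \<in> S \<Longrightarrow> U t holomorphic_on UNIV"
    and deriv_t: "((\<lambda>s. U s z) has_vector_derivative D) (at t)"
  shows "((\<lambda>(t, z). U t z) has_derivative (\<lambda>(h, k). h *\<^sub>R D + deriv (U t) z * k)) (at (t, z))"
proof -
  have "((\<lambda>(t, z). U t z) has_derivative
      (\<lambda>(h, k). h *\<^sub>R D + blinfun_apply (blinfun_mult_right (deriv (U t) z)) k))
      (at (t, z) within S \<times> UNIV)"
  proof (rule has_derivative_partialsI)
    show "((\<lambda>s. U s z) has_derivative (\<lambda>h. h *\<^sub>R D)) (at t within S)"
      using deriv_t by (simp add: has_vector_derivative_def has_derivative_at_withinI)
    show "((\<lambda>z. U t z) has_derivative blinfun_apply (blinfun_mult_right (deriv (U t) z)))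
        (at z within UNIV)" if "t \<in> S" for t z
      using holomorphic_derivI[OF hol[OF that], of z]
      by (simp add: has_field_derivative_def)
    have "continuous_on (S \<times> UNIV) (\<lambda>x. blinfun_mult_right (case x of (t, z) \<Rightarrow> deriv (U t) z))"
      by (intro bounded_linear.continuous_on[OF bounded_linear_blinfun_mult_right]
          continuous_on_deriv_parametric cont hol)
    then show "continuous (at (t, z) within S \<times> UNIV)
        (\<lambda>(t, z). blinfun_mult_right (deriv (U t) z))"
      using \<open>t \<in> S\<close> by (auto simp: continuous_on_eq_continuous_within case_prod_unfold)
  qed auto
  then show ?thesis
    using at_within_open[of "(t, z)" "S \<times> UNIV"] \<open>t \<in> S\<close> \<open>open S\<close>
    by (simp add: open_Times)
qed

lemma dirac_heat_solution_unique:
  assumes "a > 0" and sol: "dirac_heat_solution a U0 U" and "t \<ge> 0"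
  shows "U t z =
    exp (z * of_real t / 2) * exp (of_real (t\<^sup>2 / (4 * a))) * U0 (z + of_real (t / a))"
proof -
  have cont: "continuous_on ({0..} \<times> UNIV) (\<lambda>(t, z). U t z)"
    and hol: "\<And>t. t > 0 \<Longrightarrow> U t holomorphic_on UNIV"
    and deriv_t: "\<And>t z. t > 0 \<Longrightarrow> ((\<lambda>s. U s z) has_vector_derivative dirac a (U t) z) (at t)"
    and init: "\<And>z. U 0 z = U0 z"
    using sol by (auto simp: dirac_heat_solution_def)
  have cont_pos: "continuous_on ({0<..} \<times> UNIV) (\<lambda>(t, z). U t z)"
    by (rule continuous_on_subset[OF cont]) auto
  \<comment> \<open>\<open>w\<close> is the point where the characteristic through \<open>(t, z)\<close> meets the initial time.\<close>
  define w where "w = z + of_real (t / a)"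
  define E where "E s = exp (of_real (s\<^sup>2 / (4 * a)) - w * of_real s / 2)" for s :: real
  define V where "V s = E s * U s (w - of_real (s / a))" for s
  have deriv_V: "(V has_vector_derivative 0) (at s)" if "s > 0" for s
  proof -
    let ?z = "w - of_real (s / a)"
    have "((\<lambda>s. (s, w - of_real (s / a))) has_derivative
        (\<lambda>h. (h, - of_real (h / a)))) (at s)"
      using \<open>a > 0\<close> by (auto intro!: derivative_eq_intros)
    moreover have "((\<lambda>(t, z). U t z) has_derivative
        (\<lambda>(h, k). h *\<^sub>R dirac a (U s) ?z + deriv (U s) ?z * k)) (at (s, ?z))"
      using that by (intro has_derivative_joint[OF cont_pos] hol deriv_t) auto
    ultimately have "((\<lambda>s. U s (w - of_real (s / a))) has_derivative
        (\<lambda>h. h *\<^sub>R dirac a (U s) ?z + deriv (U s) ?z * (- of_real (h / a)))) (at s)"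
      using has_derivative_compose[where f = "\<lambda>s. (s, w - of_real (s / a))"
          and g = "\<lambda>(t, z). U t z"] by fastforce
    moreover have "(\<lambda>h. h *\<^sub>R dirac a (U s) ?z + deriv (U s) ?z * (- of_real (h / a)))
        = (\<lambda>h. h *\<^sub>R (?z / 2 * U s ?z))"
      by (auto simp: dirac_def scaleR_conv_of_real algebra_simps)
    ultimately have deriv_U: "((\<lambda>s. U s (w - of_real (s / a))) has_vector_derivative
        ?z / 2 * U s ?z) (at s)"
      by (simp add: has_vector_derivative_def)
    have "((\<lambda>s. exp (of_real (s\<^sup>2 / (4 * a)) - w * of_real s / 2))
        has_vector_derivative E s * (of_real (s / (2 * a)) - w / 2)) (at s)"
    proof -
      have "((\<lambda>x. exp (x\<^sup>2 / (4 * of_real a) - w * x / 2)) has_field_derivative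
          E s * (of_real (s / (2 * a)) - w / 2)) (at (of_real s))"
        using \<open>a > 0\<close> by (auto intro!: derivative_eq_intros simp: E_def field_simps)
      from has_vector_derivative_real_field[OF this] show ?thesis
        by simp
    qed
    then have deriv_E: "(E has_vector_derivative E s * (of_real (s / (2 * a)) - w / 2)) (at s)"
      by (simp add: E_def[abs_def])
    have "E s * (?z / 2 * U s ?z) + E s * (of_real (s / (2 * a)) - w / 2) * U s ?z = 0"
      using \<open>a > 0\<close> by (simp add: field_simps)
    then show ?thesis
      using has_vector_derivative_mult[OF deriv_E deriv_U] by (simp add: V_def[abs_def])
  qed
  have "continuous_on {0..t} ((\<lambda>(t, z). U t z) \<circ> (\<lambda>s. (s, w - of_real (s / a))))"
    using \<open>a > 0\<close>
    by (intro continuous_on_compose continuous_intros continuous_on_subset[OF cont]) auto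
  then have cont_V: "continuous_on {0..t} V"
    unfolding V_def E_def using \<open>a > 0\<close> by (auto intro!: continuous_intros simp: o_def)
  have "V t = V 0"
  proof (rule has_derivative_zero_unique_strong_interval[of "{0}" 0 t])
    fix s assume "s \<in> {0..t} - {0}"
    then show "(V has_derivative (\<lambda>h. 0)) (at s within {0..t})"
      using deriv_V[of s] by (auto simp: has_vector_derivative_def has_derivative_at_withinI)
  qed (use cont_V \<open>t \<ge> 0\<close> in auto)
  then have "E t * U t z = U0 w"
    by (simp add: V_def E_def init w_def)
  moreover have "exp (z * of_real t / 2) * exp (of_real (t\<^sup>2 / (4 * a))) * E t = 1"
    unfolding E_def w_def mult_exp_exp
    using \<open>a > 0\<close> by (simp add: field_simps power2_eq_square)
  ultimately show ?thesis
    unfolding w_def by (metis mult.assoc mult_1)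
qed

lemma dirac_heat_solution_formula:
  assumes "a > 0" and hol0: "U0 holomorphic_on UNIV"
    and U: "\<And>t z. t \<ge> 0 \<Longrightarrow> U t z =
      exp (z * of_real t / 2) * exp (of_real (t\<^sup>2 / (4 * a))) * U0 (z + of_real (t / a))"
  shows "dirac_heat_solution a U0 U"
proof -
  \<comment> \<open>With \<open>t\<close> complex, both partial derivatives are complex derivatives.\<close>
  define F where "F t z = exp (z * t / 2) * exp (t\<^sup>2 / (4 * of_real a)) * U0 (z + t / of_real a)"
    for t z :: complex
  have U_F: "U t z = F (of_real t) z" if "t \<ge> 0" for t z
    using U[OF that] by (simp add: F_def)
  have deriv0: "(U0 has_field_derivative deriv U0 x) (at x)" for x
    using holomorphic_derivI[OF hol0, of x] by simp
  note [derivative_intros] = DERIV_chain2[OF deriv0]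
  have F_z: "(F t has_field_derivative
      t / 2 * F t z + exp (z * t / 2) * exp (t\<^sup>2 / (4 * of_real a)) * deriv U0 (z + t / of_real a))
      (at z)" for t z
    unfolding F_def[abs_def] by (auto intro!: derivative_eq_intros simp: field_simps)
  have F_t: "((\<lambda>t. F t z) has_field_derivative dirac a (F t) z) (at t)" for t z
    unfolding dirac_def DERIV_imp_deriv[OF F_z] unfolding F_def[abs_def]
    using \<open>a > 0\<close> by (auto intro!: derivative_eq_intros simp: field_simps)
  have "continuous_on ({0..} \<times> UNIV) (\<lambda>x::real \<times> complex. F (of_real (fst x)) (snd x))"
    unfolding F_def using \<open>a > 0\<close>
    by (intro continuous_intros continuous_on_compose2[OF holomorphic_on_imp_continuous_on[OF hol0]])
      auto
  then have "continuous_on ({0..} \<times> UNIV) (\<lambda>(t, z). U t z)"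
    by (rule continuous_on_cong[THEN iffD1, rotated -1]) (auto simp: U_F)
  moreover have U_eq: "U t = F (of_real t)" if "t > 0" for t
    using U_F that by auto
  moreover have "F t holomorphic_on UNIV" for t
    using F_z by (auto simp: holomorphic_on_def field_differentiable_def)
  moreover have "((\<lambda>s. U s z) has_vector_derivative dirac a (U t) z) (at t)" if "t > 0" for t z
  proof -
    have "((\<lambda>s. F (of_real s) z) has_vector_derivative dirac a (U t) z) (at t)"
      unfolding U_eq[OF that] by (rule has_vector_derivative_real_field[OF F_t])
    then show ?thesis
      by (rule has_vector_derivative_transform_within_open[where S = "{0<..}"])
        (use that U_eq in auto)
  qed
  moreover have "U 0 z = U0 z" for z
    using U[of 0 z] by simp
  ultimately show ?thesis
    unfolding dirac_heat_solution_def by simp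
qed

theorem theorem3p1:
  fixes a :: real and U0 :: "complex \<Rightarrow> complex" and U :: "real \<Rightarrow> complex \<Rightarrow> complex"
  assumes "a > 0" and "U0 \<in> fock_space (a / 2)"
  shows "dirac_heat_solution a U0 U \<longleftrightarrow>
    (\<forall>t\<ge>0. \<forall>z. U t z =
       exp (z * of_real t / 2) * exp (of_real (t\<^sup>2 / (4 * a))) * U0 (z + of_real (t / a)))"
proof -
  have "U0 holomorphic_on UNIV"
    using assms(2) by (simp add: fock_space_def)
  then show ?thesis
    using dirac_heat_solution_unique dirac_heat_solution_formula \<open>a > 0\<close> by blast
qed

end
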